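(* Let $k\ge 1$ and let $G=(V,E)$ be a (simple) graph with vertex set $V=\{1,2,\dots,k\}$. For a $k$-tuple of positive integers $u=(u_1,\dots,u_k)$ and a positive integer $n$, let $Q_G^{(u)}(n)$ be the number of $k$-tuples $(a_1,\dots,a_k)$ of integers with $1\le a_1,\dots,a_k\le n$ such that $\gcd(a_i,u_i)=1$ for $i=1,\dots,k$ and $\gcd(a_i,a_j)=1$ for every edge $\{i,j\}\in E$. Define $$A_G=\prod_p\left(\sum_{m=0}^{k} i_m(G)\left(1-\frac1p\right)^{k-m}\frac{1}{p^m}\right),$$ $$f_G(u)=\prod_{p\mid u_1u_2\cdots u_k}\left(1-\frac{\sum_{m=0}^{k} i_{m,S(u,p)}(G)\,(p-1)^{k-m}}{\sum_{m=0}^{k} i_m(G)\,(p-1)^{k-m}}\right),$$ where the products run over primes $p$. Then, uniformly for all integers $n\ge 2$ and all $u_1,\dots,u_k\ge 1$, $$Q_G^{(u)}(n)=A_G\,f_G(u)\,n^k+O\!\left(\theta(u)\,n^{k-1}\log^{k-1} n\right),$$ where the implied constant depends only on $G$.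
   Context: A subset $S\subseteq V$ is independent if no two vertices of $S$ are adjacent in $G$ (the empty set is independent). $i_m(G)$ denotes the number of independent sets of cardinality $m$ in $G$ (so $i_0(G)=1$). For $S\subseteq V$, $i_{m,S}(G)$ denotes the number of independent sets of cardinality $m$ in $G$ containing at least one vertex of $S$. For a $k$-tuple $u=(u_1,\dots,u_k)$ and an integer $d$, $S(u,d)$ is the set of indices $i$ with $1\le i\le k$ such that $d\mid u_i$. For a positive integer $a$, $\theta(a)$ is the number of square-free divisors of $a$, and $\theta(u)=\max\{\theta(u_i): i=1,\dots,k\}$. *)

theory Defs
  imports
    "HOL-Analysis.Analysis"
    "HOL-Computational_Algebra.Computational_Algebra"
    "HOL-Library.Ramsey"
begin

text \<open>
  A simple graph on the vertex set \<open>{1..k}\<close> is given by its edge set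
  \<open>E \<subseteq> [{1..k}]\<^bsup>2\<^esup>\<close>, the edges being two-element sets of vertices.
  Tuples \<open>u\<close> are functions of which only the values on \<open>{1..k}\<close> matter.
\<close>

definition indep_sets :: "nat \<Rightarrow> nat set set \<Rightarrow> nat \<Rightarrow> nat set set" where
  "indep_sets k E m = {A. A \<subseteq> {1..k} \<and> card A = m \<and> indep A E}"

definition num_indep :: "nat \<Rightarrow> nat set set \<Rightarrow> nat \<Rightarrow> nat" where
  "num_indep k E m = card (indep_sets k E m)"

definition num_indep_meeting :: "nat \<Rightarrow> nat set set \<Rightarrow> nat \<Rightarrow> nat set \<Rightarrow> nat" where
  "num_indep_meeting k E m S = card {A \<in> indep_sets k E m. A \<inter> S \<noteq> {}}"

definition dvd_indices :: "nat \<Rightarrow> (nat \<Rightarrow> nat) \<Rightarrow> nat \<Rightarrow> nat set" where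
  "dvd_indices k u d = {i \<in> {1..k}. d dvd u i}"

definition num_squarefree_divisors :: "nat \<Rightarrow> nat" where
  "num_squarefree_divisors a = card {d. d dvd a \<and> squarefree d}"

definition max_squarefree_divisors :: "nat \<Rightarrow> (nat \<Rightarrow> nat) \<Rightarrow> nat" where
  "max_squarefree_divisors k u = Max ((\<lambda>i. num_squarefree_divisors (u i)) ` {1..k})"

definition count_tuples :: "nat \<Rightarrow> nat set set \<Rightarrow> (nat \<Rightarrow> nat) \<Rightarrow> nat \<Rightarrow> nat" where
  "count_tuples k E u n =
     card {a \<in> {1..k} \<rightarrow>\<^sub>E {1..n}.
             (\<forall>i\<in>{1..k}. gcd (a i) (u i) = 1) \<and>
             (\<forall>i j. {i, j} \<in> E \<longrightarrow> gcd (a i) (a j) = 1)}"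

text \<open>
  The product over all primes is taken in increasing order, as an infinite product over the
  natural numbers whose factors at non-primes are \<open>1\<close>. As \<^const>\<open>prodinf\<close> is unspecified for
  divergent products, statements about \<open>density_const\<close> should come with the convergence of
  \<open>density_factor\<close>.
\<close>

definition density_factor :: "nat \<Rightarrow> nat set set \<Rightarrow> nat \<Rightarrow> real" where
  "density_factor k E p =
     (if prime p
      then \<Sum>m=0..k. real (num_indep k E m) * (1 - 1 / real p) ^ (k - m) * (1 / real p ^ m)
      else 1)"

definition density_const :: "nat \<Rightarrow> nat set set \<Rightarrow> real" where
  "density_const k E = (\<Prod>p. density_factor k E p)"

definition local_correction :: "nat \<Rightarrow> nat set set \<Rightarrow> (nat \<Rightarrow> nat) \<Rightarrow> real" where
  "local_correction k E u =
     (\<Prod>p\<in>{p. prime p \<and> p dvd (\<Prod>i=1..k. u i)}.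
        1 - (\<Sum>m=0..k. real (num_indep_meeting k E m (dvd_indices k u p)) * (real p - 1) ^ (k - m)) /
            (\<Sum>m=0..k. real (num_indep k E m) * (real p - 1) ^ (k - m)))"

end

theory Submission
  imports Defs
begin

text \<open>
  The vertices are added one at a time.  Fixing the value \<open>b\<close> of the coordinate at \<open>v\<close> turns the edge
  conditions at \<open>v\<close> into coprimality conditions: \<open>u i\<close> is replaced by \<open>u i * b\<close> for the neighbours \<open>i\<close>
  of \<open>v\<close>.  The accumulated error is then controlled by the submultiplicativity of the number \<open>\<theta>\<close> of
  square-free divisors and by \<open>(\<Sum>b\<le>n. \<theta> b) = O(n ln n)\<close>.  As a function of \<open>b\<close>, the main term is a
  constant times a product of factors \<open>1 + h p\<close> over the primes \<open>p dvd b\<close>, where \<open>h p = -1\<close> if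
  \<open>p dvd u v\<close> and \<open>h p = O(1 / p)\<close> otherwise.  Expanding the product over square-free \<open>d dvd b\<close> and
  summing over \<open>b \<le> n\<close> replaces each \<open>n div d\<close> by \<open>n / d\<close>.  By Rankin's trick the total rounding error is
  at most \<open>n powr \<epsilon>\<close> times a product over primes, which is \<open>O(\<theta> (u v) * ln n ^ k)\<close> for
  \<open>\<epsilon> = 1 / (1 + ln n)\<close>, because the sum of \<open>d powr -(1 + \<epsilon>)\<close> is at most \<open>1 + 1 / \<epsilon>\<close>.  All this takes place
  over a finite set of primes containing those up to \<open>n\<close>; the infinite product appears only in a
  final limit.
\<close>

section \<open>Sums of multiplicative functions\<close>

lemma sum_inverse_le_one_plus_ln: "n \<ge> 1 \<Longrightarrow> (\<Sum>d=1..n. 1 / real d) \<le> 1 + ln (real n)"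
proof (induction n rule: dec_induct)
  case (step n)
  have "ln (real n / real (Suc n)) \<le> real n / real (Suc n) - 1"
    using step by (intro ln_le_minus_one) auto
  also have "real n / real (Suc n) - 1 = - (1 / real (Suc n))"
    by (simp add: field_simps)
  finally have "1 / real (Suc n) \<le> ln (real (Suc n)) - ln (real n)"
    using step by (simp add: ln_div)
  with step show ?case by simp
qed simp

text \<open>The mean value theorem writes
  \<open>x powr (-\<epsilon>) - (x + 1) powr (-\<epsilon>)\<close> as
  \<open>\<epsilon> * z powr (-(1+\<epsilon>))\<close> with \<open>z < x + 1\<close>, and this power
  decreases in \<open>z\<close>. The right-hand side telescopes when summed.\<close>

lemma powr_one_plus_le_telescope:
  fixes \<epsilon> x :: real
  assumes "\<epsilon> > 0" "x \<ge> 1"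
  shows "(x + 1) powr (-(1+\<epsilon>)) \<le> (x powr (-\<epsilon>) - (x + 1) powr (-\<epsilon>)) / \<epsilon>"
proof -
  have "\<exists>z. x < z \<and> z < x + 1 \<and>
      (x + 1) powr (-\<epsilon>) - x powr (-\<epsilon>) = (x + 1 - x) * (-\<epsilon> * z powr (-\<epsilon> - 1))"
    using assms by (intro MVT2) (auto intro!: derivative_eq_intros simp: field_simps powr_diff)
  then obtain z where z: "x < z" "z < x + 1"
    "x powr (-\<epsilon>) - (x + 1) powr (-\<epsilon>) = \<epsilon> * z powr (-(1+\<epsilon>))"
    by (auto simp: algebra_simps minus_diff_commute)
  have "(x + 1) powr (-(1+\<epsilon>)) \<le> z powr (-(1+\<epsilon>))"
    using z assms by (intro powr_mono2') auto
  with z assms show ?thesis by (simp add: field_simps)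
qed

lemma sum_powr_le:
  fixes \<epsilon> :: real
  assumes "\<epsilon> > 0"
  shows "(\<Sum>d=1..n. real d powr (-(1+\<epsilon>))) \<le> 1 + 1 / \<epsilon>"
proof -
  \<comment> \<open>The negative term is kept so that the telescoping induction closes. Starting at
    \<open>Suc 0\<close> isolates the term \<open>d = 1\<close>, which the telescoping bound does
    not cover.\<close>
  have "(\<Sum>d=1..Suc n. real d powr (-(1+\<epsilon>))) \<le> 1 + (1 - real (Suc n) powr (-\<epsilon>)) / \<epsilon>" for n
  proof (induction n)
    case (Suc n)
    show ?case
      using Suc powr_one_plus_le_telescope[OF assms, of "real (Suc n)"]
      by (simp add: diff_divide_distrib add_ac)
  qed simp
  moreover have "1 + (1 - real (Suc n) powr (-\<epsilon>)) / \<epsilon> \<le> 1 + 1 / \<epsilon>" for n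
    using assms by (simp add: field_simps)
  ultimately have "(\<Sum>d=1..Suc n. real d powr (-(1+\<epsilon>))) \<le> 1 + 1 / \<epsilon>" for n
    by (rule order_trans)
  then show ?thesis
    using assms by (cases n) (simp_all del: sum.cl_ivl_Suc)
qed

section \<open>Square-free numbers as products of sets of primes\<close>

lemma prime_dvd_prod_primes_iff:
  fixes T :: "nat set"
  assumes "finite T" "\<And>p. p \<in> T \<Longrightarrow> prime p" "prime q"
  shows "q dvd \<Prod>T \<longleftrightarrow> q \<in> T"
proof -
  have "q dvd \<Prod>T \<longleftrightarrow> (\<exists>x\<in>T. q dvd x)"
    using assms(1,3) by (rule prime_dvd_prod_iff)
  also have "\<dots> \<longleftrightarrow> q \<in> T"
  proof
    assume "\<exists>x\<in>T. q dvd x"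
    then obtain x where x: "x \<in> T" "q dvd x" ..
    then have "q = x"
      using assms(3) assms(2)[OF x(1)] by (intro primes_dvd_imp_eq)
    with x show "q \<in> T" by simp
  qed (rule bexI[of _ q], simp_all)
  finally show ?thesis .
qed

text \<open>Unique factorization of square-free numbers: \<open>X\<close> is recovered from
  \<open>\<Prod>X\<close> as the set of members of \<open>P\<close> dividing it. Sums over
  square-free numbers can thus be indexed by sets of primes.\<close>

lemma inj_on_prod_primes:
  fixes P :: "nat set"
  assumes "finite P" "\<And>p. p \<in> P \<Longrightarrow> prime p"
  shows "inj_on \<Prod> (Pow P)"
proof (rule inj_onI)
  fix S T assume ST: "S \<in> Pow P" "T \<in> Pow P" "\<Prod>S = \<Prod>T"
  have *: "q \<in> X \<longleftrightarrow> q \<in> P \<and> q dvd \<Prod>X" if "X \<in> Pow P" for X q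
  proof -
    have "X \<subseteq> P" using that by simp
    moreover from this have "finite X"
      using assms(1) by (rule finite_subset)
    ultimately have "q dvd \<Prod>X \<longleftrightarrow> q \<in> X" if "q \<in> P"
      using that assms(2) by (intro prime_dvd_prod_primes_iff) auto
    with \<open>X \<subseteq> P\<close> show ?thesis by auto
  qed
  show "S = T"
    by (rule set_eqI) (simp only: *[OF ST(1)] *[OF ST(2)] ST(3))
qed

lemma prod_primes_dvd_iff:
  fixes T :: "nat set"
  assumes "finite T" "\<And>p. p \<in> T \<Longrightarrow> prime p"
  shows "\<Prod>T dvd a \<longleftrightarrow> (\<forall>p\<in>T. p dvd a)"
  using assms
proof (induction T rule: finite_induct)
  case (insert q T)
  have "coprime q (\<Prod>T)"
    using insert by (intro prod_coprime_right) (metis insertCI primes_coprime)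
  then show ?case
    using insert by (auto simp: divides_mult dest: dvd_mult_left dvd_mult_right)
qed simp

lemma squarefree_prod_primes:
  fixes T :: "nat set"
  assumes "finite T" "\<And>p. p \<in> T \<Longrightarrow> prime p"
  shows "squarefree (\<Prod>T)"
proof (rule squarefree_prod_coprime)
  show "coprime p q" if "p \<in> T" "q \<in> T" "p \<noteq> q" for p q
    using that assms(2) by (intro primes_coprime)
  show "squarefree p" if "p \<in> T" for p
    using that assms(2) by (intro squarefree_prime)
qed

text \<open>Expanding the product gives the terms \<open>d powr -(1+\<epsilon>)\<close> for distinct
  square-free \<open>d\<close>, which form part of the sum over all \<open>d\<close>. The bound does
  not depend on \<open>P\<close>.\<close>

lemma prod_one_plus_powr_le:
  fixes P :: "nat set" and \<epsilon> :: real
  assumes "finite P" "\<And>p. p \<in> P \<Longrightarrow> prime p" "\<epsilon> > 0"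
  shows "(\<Prod>p\<in>P. 1 + real p powr (-(1+\<epsilon>))) \<le> 1 + 1 / \<epsilon>"
proof -
  have "(\<Prod>p\<in>P. 1 + real p powr (-(1+\<epsilon>)))
      = (\<Sum>T\<in>Pow P. (\<Prod>p\<in>T. real p powr (-(1+\<epsilon>))))"
    using assms(1) by (subst add.commute, subst prod_add) simp_all
  also have "\<dots> = (\<Sum>T\<in>Pow P. real (\<Prod>T) powr (-(1+\<epsilon>)))"
    by (simp add: prod_powr_distrib)
  also have "\<dots> = (\<Sum>d\<in>\<Prod> ` Pow P. real d powr (-(1+\<epsilon>)))"
    using inj_on_prod_primes[OF assms(1,2)] by (simp add: sum.reindex)
  also have "\<dots> \<le> (\<Sum>d=1..Max (\<Prod> ` Pow P). real d powr (-(1+\<epsilon>)))"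
  proof (rule sum_mono2)
    have "\<Prod>T \<ge> 1" if "T \<subseteq> P" for T
      using that assms(2) by (auto simp: Suc_le_eq intro!: prod_pos dest: prime_gt_0_nat)
    then show "\<Prod> ` Pow P \<subseteq> {1..Max (\<Prod> ` Pow P)}"
      using assms(1) by (auto intro!: Max_ge)
  qed auto
  also have "\<dots> \<le> 1 + 1 / \<epsilon>"
    by (rule sum_powr_le) fact
  finally show ?thesis .
qed

section \<open>The number of square-free divisors\<close>

lemma finite_squarefree_divisors: "a > 0 \<Longrightarrow> finite {d::nat. d dvd a \<and> squarefree d}"
  by (rule finite_subset[of _ "{..a}"]) (auto dest: dvd_imp_le)

text \<open>A divisor of \<open>a * b\<close> is a divisor of \<open>a\<close> times a divisor of
  \<open>b\<close>, and both inherit square-freeness; so the products of pairs cover everything that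
  is counted on the left.\<close>

lemma num_squarefree_divisors_mult_le:
  assumes "a > 0" "b > 0"
  shows "num_squarefree_divisors (a * b) \<le> num_squarefree_divisors a * num_squarefree_divisors b"
proof -
  let ?D = "\<lambda>a. {d::nat. d dvd a \<and> squarefree d}"
  have "?D (a * b) \<subseteq> (\<lambda>(x, y). x * y) ` (?D a \<times> ?D b)"
  proof
    fix d assume d: "d \<in> ?D (a * b)"
    then obtain x y where xy: "d = x * y" "x dvd a" "y dvd b"
      by (auto elim: dvd_productE)
    with d have "(x, y) \<in> ?D a \<times> ?D b"
      by (auto intro: squarefree_mono[of x d] squarefree_mono[of y d])
    with xy show "d \<in> (\<lambda>(x, y). x * y) ` (?D a \<times> ?D b)" by force
  qed
  then have "card (?D (a * b)) \<le> card (?D a \<times> ?D b)"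
    using assms by (intro surj_card_le) (auto simp: finite_squarefree_divisors)
  then show ?thesis
    by (simp add: num_squarefree_divisors_def card_cartesian_product)
qed

text \<open>Distinct sets of primes dividing \<open>w\<close> have distinct square-free products,
  all dividing \<open>w\<close>. This turns a factor 2 at each prime dividing \<open>w\<close> into
  \<open>\<theta> w\<close>.\<close>

lemma power_card_prime_divisors_le:
  assumes "finite P" "\<And>p. p \<in> P \<Longrightarrow> prime p" "w > 0"
  shows "2 ^ card {p \<in> P. p dvd w} \<le> num_squarefree_divisors w"
proof -
  let ?Q = "{p \<in> P. p dvd w}"
  have "\<Prod> ` Pow ?Q \<subseteq> {d. d dvd w \<and> squarefree d}"
  proof safe
    fix T assume T: "T \<subseteq> ?Q"
    then have "finite T" "\<And>p. p \<in> T \<Longrightarrow> prime p"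
      using assms finite_subset[of T P] by auto
    with T show "\<Prod>T dvd w" "squarefree (\<Prod>T)"
      by (auto simp: prod_primes_dvd_iff squarefree_prod_primes)
  qed
  then have "card (\<Prod> ` Pow ?Q) \<le> num_squarefree_divisors w"
    unfolding num_squarefree_divisors_def
    using assms(3) by (intro card_mono finite_squarefree_divisors)
  moreover have "inj_on \<Prod> (Pow ?Q)"
    by (rule inj_on_prod_primes) (use assms in auto)
  ultimately show ?thesis
    using assms(1) by (simp add: card_image card_Pow)
qed

lemma card_multiples: "card {a \<in> {1..n}. d dvd a} = n div d" if "d > 0" for d n :: nat
proof -
  have "{a \<in> {1..n}. d dvd a} = (*) d ` {1..n div d}"
    using that by (auto simp: less_eq_div_iff_mult_less_eq mult.commute)
  then show ?thesis
    using that by (simp add: card_image inj_on_mult)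
qed

lemma num_squarefree_divisors_ge_1: "a > 0 \<Longrightarrow> num_squarefree_divisors a \<ge> 1"
  using power_card_prime_divisors_le[of "{}" a] by simp

text \<open>All divisors are counted instead of the square-free ones; exchanging the sums leaves
  \<open>n div d\<close> for each \<open>d \<le> n\<close>, hence a harmonic sum.\<close>

lemma sum_num_squarefree_divisors_le:
  assumes "n \<ge> 1"
  shows "(\<Sum>a=1..n. real (num_squarefree_divisors a)) \<le> real n * (1 + ln (real n))"
proof -
  have "num_squarefree_divisors a \<le> (\<Sum>d=1..n. of_bool (d dvd a))" if "a \<in> {1..n}" for a
  proof -
    have "num_squarefree_divisors a \<le> card {d \<in> {1..n}. d dvd a}"
      unfolding num_squarefree_divisors_def using that
      by (intro card_mono) (auto dest: dvd_imp_le simp: Suc_le_eq intro: Nat.gr0I)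
    then show ?thesis by (simp add: Int_def)
  qed
  then have "(\<Sum>a=1..n. num_squarefree_divisors a) \<le> (\<Sum>a=1..n. \<Sum>d=1..n. of_bool (d dvd a))"
    by (rule sum_mono)
  also have "\<dots> = (\<Sum>d=1..n. \<Sum>a=1..n. of_bool (d dvd a))"
    by (rule sum.swap)
  also have "\<dots> = (\<Sum>d=1..n. n div d)"
    by (intro sum.cong refl) (simp add: card_multiples[symmetric] Int_def)
  finally have "(\<Sum>a=1..n. real (num_squarefree_divisors a)) \<le> (\<Sum>d=1..n. real (n div d))"
    by (metis of_nat_le_iff of_nat_sum)
  also have "\<dots> \<le> (\<Sum>d=1..n. real n * (1 / real d))"
    by (intro sum_mono) (simp add: of_nat_div_le_of_nat)
  also have "\<dots> = real n * (\<Sum>d=1..n. 1 / real d)"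
    by (simp add: sum_distrib_left)
  also have "\<dots> \<le> real n * (1 + ln (real n))"
    using sum_inverse_le_one_plus_ln[OF assms] by (intro mult_left_mono) auto
  finally show ?thesis .
qed

text \<open>Rankin's trick: the rounding error of \<open>n div d\<close> is at most \<open>min 1 (n / d) \<le> (n / d) powr \<epsilon>\<close>.\<close>

lemma abs_div_diff_le_powr:
  fixes n d :: nat and \<epsilon> :: real
  assumes "d > 0" "n > 0" "0 \<le> \<epsilon>" "\<epsilon> \<le> 1"
  shows "\<bar>real (n div d) - real n / real d\<bar> \<le> (real n / real d) powr \<epsilon>"
proof (cases "n < d")
  case True
  then have "(real n / real d) powr 1 \<le> (real n / real d) powr \<epsilon>"
    using assms by (intro powr_mono') auto
  then show ?thesis using True assms by simp
next
  case False
  have "real_of_int \<lfloor>real n / real d\<rfloor> = real (n div d)"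
    by (simp add: floor_divide_of_nat_eq)
  then have "real n / real d - 1 < real (n div d)"
    by linarith
  moreover have "real (n div d) \<le> real n / real d"
    by (rule of_nat_div_le_of_nat)
  moreover have "1 \<le> (real n / real d) powr \<epsilon>"
    using False assms by (intro ge_one_powr_ge_zero) auto
  ultimately show ?thesis by linarith
qed

text \<open>The subsets \<open>T\<close> of \<open>P\<close> stand for the square-free numbers
  \<open>\<Prod>T\<close>. Once both products are expanded, the two quantities differ term by term
  only in \<open>n div \<Prod>T\<close> against \<open>n / \<Prod>T\<close>.\<close>

lemma sum_multiplicative_approx:
  fixes P :: "nat set" and h :: "nat \<Rightarrow> real" and n :: nat and \<epsilon> :: real
  assumes "finite P" "\<And>p. p \<in> P \<Longrightarrow> prime p" "n > 0" "0 \<le> \<epsilon>" "\<epsilon> \<le> 1"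
  shows "\<bar>(\<Sum>a=1..n. \<Prod>p\<in>{p\<in>P. p dvd a}. 1 + h p) - real n * (\<Prod>p\<in>P. 1 + h p / real p)\<bar>
         \<le> real n powr \<epsilon> * (\<Prod>p\<in>P. 1 + \<bar>h p\<bar> * real p powr (-\<epsilon>))"
proof -
  have fin: "finite T" and pr: "\<And>p. p \<in> T \<Longrightarrow> prime p" and pos: "\<Prod>T > 0" if "T \<subseteq> P" for T
    using assms that finite_subset[OF that] by (auto intro!: prod_pos dest: prime_gt_0_nat)
  have expand: "(\<Prod>p\<in>A. 1 + f p) = (\<Sum>T\<in>Pow A. \<Prod>p\<in>T. f p)" if "finite A" for A and f :: "nat \<Rightarrow> real"
    using that by (subst add.commute, subst prod_add) simp_all
  have "(\<Sum>a=1..n. \<Prod>p\<in>{p\<in>P. p dvd a}. 1 + h p)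
      = (\<Sum>a=1..n. \<Sum>T\<in>Pow P. prod h T * of_bool (\<Prod>T dvd a))"
  proof (intro sum.cong refl)
    fix a assume "a \<in> {1..n}"
    have Pow_eq: "Pow {p\<in>P. p dvd a} = {T\<in>Pow P. \<Prod>T dvd a}"
    proof -
      have "\<Prod>T dvd a \<longleftrightarrow> (\<forall>p\<in>T. p dvd a)" if "T \<subseteq> P" for T
        using fin[OF that] pr[OF that] by (rule prod_primes_dvd_iff)
      then show ?thesis by auto
    qed
    have "(\<Prod>p\<in>{p\<in>P. p dvd a}. 1 + h p) = (\<Sum>T\<in>Pow {p\<in>P. p dvd a}. prod h T)"
      using assms(1) by (simp add: expand)
    also have "\<dots> = (\<Sum>T\<in>Pow P. prod h T * of_bool (\<Prod>T dvd a))"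
      using assms(1) by (simp add: Pow_eq Int_def flip: sum.inter_filter)
    finally show "(\<Prod>p\<in>{p\<in>P. p dvd a}. 1 + h p) = (\<Sum>T\<in>Pow P. prod h T * of_bool (\<Prod>T dvd a))" .
  qed
  also have "\<dots> = (\<Sum>T\<in>Pow P. prod h T * (\<Sum>a=1..n. of_bool (\<Prod>T dvd a)))"
    by (subst sum.swap) (simp only: sum_distrib_left)
  also have "\<dots> = (\<Sum>T\<in>Pow P. prod h T * real (n div \<Prod>T))"
  proof (intro sum.cong refl arg_cong2[where f = "(*)"])
    fix T assume "T \<in> Pow P"
    then show "(\<Sum>a=1..n. of_bool (\<Prod>T dvd a)) = real (n div \<Prod>T)"
      using card_multiples[OF pos, of T n] by (simp add: Int_def)
  qed
  finally have 1: "(\<Sum>a=1..n. \<Prod>p\<in>{p\<in>P. p dvd a}. 1 + h p) = (\<Sum>T\<in>Pow P. prod h T * real (n div \<Prod>T))" .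
  have 2: "real n * (\<Prod>p\<in>P. 1 + h p / real p) = (\<Sum>T\<in>Pow P. prod h T * (real n / real (\<Prod>T)))"
    using assms(1) by (simp add: expand sum_distrib_left prod_dividef mult_ac)
  have "\<bar>(\<Sum>T\<in>Pow P. prod h T * real (n div \<Prod>T)) - (\<Sum>T\<in>Pow P. prod h T * (real n / real (\<Prod>T)))\<bar>
      \<le> (\<Sum>T\<in>Pow P. \<bar>prod h T\<bar> * \<bar>real (n div \<Prod>T) - real n / real (\<Prod>T)\<bar>)"
    unfolding sum_subtractf[symmetric] right_diff_distrib[symmetric] abs_mult[symmetric]
    by (rule sum_abs)
  also have "\<dots> \<le> (\<Sum>T\<in>Pow P. \<bar>prod h T\<bar> * (real n / real (\<Prod>T)) powr \<epsilon>)"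
    by (intro sum_mono mult_left_mono abs_div_diff_le_powr) (use assms pos in auto)
  also have "\<dots> = (\<Sum>T\<in>Pow P. real n powr \<epsilon> * (\<Prod>p\<in>T. \<bar>h p\<bar> * real p powr (-\<epsilon>)))"
  proof (intro sum.cong refl)
    fix T assume "T \<in> Pow P"
    have "(real n / real (\<Prod>T)) powr \<epsilon> = real n powr \<epsilon> * real (\<Prod>T) powr (-\<epsilon>)"
      by (simp add: powr_divide powr_minus divide_simps)
    also have "real (\<Prod>T) powr (-\<epsilon>) = (\<Prod>p\<in>T. real p powr (-\<epsilon>))"
      by (simp add: prod_powr_distrib)
    finally show "\<bar>prod h T\<bar> * (real n / real (\<Prod>T)) powr \<epsilon> = real n powr \<epsilon> * (\<Prod>p\<in>T. \<bar>h p\<bar> * real p powr (-\<epsilon>))"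
      by (simp add: prod.distrib abs_prod)
  qed
  \<comment> \<open>The error terms are again products over \<open>T\<close>, so their sum folds
    back into a product over \<open>P\<close>.\<close>
  also have "\<dots> = real n powr \<epsilon> * (\<Prod>p\<in>P. 1 + \<bar>h p\<bar> * real p powr (-\<epsilon>))"
    using assms(1) by (simp add: expand sum_distrib_left)
  finally show ?thesis unfolding 1 2 .
qed

text \<open>In the application \<open>w\<close> is \<open>u v\<close> and \<open>K\<close> is the
  number of vertices already present. Primes dividing \<open>w\<close> contribute at most 2 each, so
  \<open>\<theta> w\<close> in all; the bound \<open>K / p\<close> at the others costs
  \<open>K\<close> powers of \<open>ln n\<close>.\<close>

lemma sum_multiplicative_error:
  fixes P :: "nat set" and h :: "nat \<Rightarrow> real" and n w K :: nat
  assumes "finite P" "\<And>p. p \<in> P \<Longrightarrow> prime p" "n \<ge> 2" "w > 0"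
    and h1: "\<And>p. p \<in> P \<Longrightarrow> p dvd w \<Longrightarrow> \<bar>h p\<bar> \<le> 1"
    and hK: "\<And>p. p \<in> P \<Longrightarrow> \<not> p dvd w \<Longrightarrow> \<bar>h p\<bar> \<le> real K / real p"
  shows "\<bar>(\<Sum>a=1..n. \<Prod>p\<in>{p\<in>P. p dvd a}. 1 + h p) - real n * (\<Prod>p\<in>P. 1 + h p / real p)\<bar>
         \<le> exp 1 * 4 ^ K * real (num_squarefree_divisors w) * ln (real n) ^ K"
proof -
  define L where "L = ln (real n)"
  \<comment> \<open>This choice keeps \<open>n powr \<epsilon>\<close> at most \<open>exp 1\<close>,
    while \<open>1 / \<epsilon>\<close> is only of order \<open>ln n\<close>.\<close>
  define \<epsilon> where "\<epsilon> = 1 / (1 + L)"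
  have "ln 2 \<le> L" using assms(3) by (simp add: L_def)
  then have L: "L \<ge> 2 / 3" using ln2_ge_two_thirds by linarith
  then have \<epsilon>: "0 < \<epsilon>" "\<epsilon> \<le> 1" "1 / \<epsilon> = 1 + L" by (auto simp: \<epsilon>_def)
  have "real n powr \<epsilon> = exp (L / (1 + L))"
    using assms(3) by (simp add: powr_def L_def \<epsilon>_def)
  also have "\<dots> \<le> exp 1" using L by simp
  finally have n\<epsilon>: "real n powr \<epsilon> \<le> exp 1" .
  let ?s = "\<lambda>p::nat. real p powr (-(1+\<epsilon>))"
  \<comment> \<open>The \<open>K\<close>-th power is at least 1, so it may be included at the primes
    dividing \<open>w\<close> too; it then extends over all of \<open>P\<close>.\<close>
  have "(\<Prod>p\<in>P. 1 + \<bar>h p\<bar> * real p powr (-\<epsilon>)) \<le> (\<Prod>p\<in>P. (if p dvd w then 2 else 1) * (1 + ?s p) ^ K)"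
  proof (intro prod_mono conjI)
    fix p assume p: "p \<in> P"
    then have p0: "real p > 0" using assms(2) prime_gt_0_nat by auto
    show "0 \<le> 1 + \<bar>h p\<bar> * real p powr (-\<epsilon>)" by simp
    show "1 + \<bar>h p\<bar> * real p powr (-\<epsilon>) \<le> (if p dvd w then 2 else 1) * (1 + ?s p) ^ K"
    proof (cases "p dvd w")
      case True
      have "real p powr (-\<epsilon>) \<le> 1"
        using powr_mono[of "-\<epsilon>" 0 "real p"] p0 \<epsilon> by simp
      then have "\<bar>h p\<bar> * real p powr (-\<epsilon>) \<le> 1 * 1"
        using h1[OF p True] by (intro mult_mono) auto
      moreover have "1 \<le> (1 + ?s p) ^ K" by (rule one_le_power) simp
      ultimately have "1 + \<bar>h p\<bar> * real p powr (-\<epsilon>) \<le> 2 * (1 + ?s p) ^ K" by linarith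
      then show ?thesis using True by (simp only: if_True)
    next
      case False
      have "\<bar>h p\<bar> * real p powr (-\<epsilon>) \<le> real K / real p * real p powr (-\<epsilon>)"
        using hK[OF p False] by (rule mult_right_mono) simp
      also have "\<dots> = real K * ?s p"
      proof -
        have "?s p = real p powr (-1) * real p powr (-\<epsilon>)"
          using powr_add[of "real p" "-1" "-\<epsilon>"] by simp
        then show ?thesis
          using p0 by (simp add: powr_minus_divide)
      qed
      finally have "1 + \<bar>h p\<bar> * real p powr (-\<epsilon>) \<le> 1 + real K * ?s p"
        by (rule add_left_mono)
      also have "\<dots> \<le> (1 + ?s p) ^ K"
        by (rule Bernoulli_inequality, rule order_trans[of _ 0], simp, rule powr_ge_zero)
      finally show ?thesis using False by (simp only: if_False mult_1)
    qed
  qed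
  also have "\<dots> = 2 ^ card {p\<in>P. p dvd w} * (\<Prod>p\<in>P. 1 + ?s p) ^ K"
    using assms(1) by (simp add: prod.distrib prod_power_distrib prod.If_cases Int_def)
  also have "\<dots> \<le> real (num_squarefree_divisors w) * (4 * L) ^ K"
  proof (intro mult_mono power_mono)
    show "2 ^ card {p\<in>P. p dvd w} \<le> real (num_squarefree_divisors w)"
      using power_card_prime_divisors_le[OF assms(1,2,4)] by (metis of_nat_le_iff of_nat_numeral of_nat_power)
    have "(\<Prod>p\<in>P. 1 + ?s p) \<le> 1 + 1 / \<epsilon>"
      using assms \<epsilon> by (intro prod_one_plus_powr_le)
    \<comment> \<open>Here \<open>1 + 1 / \<epsilon> = 2 + L\<close>, and
      \<open>2 \<le> 3 * L\<close> because \<open>L \<ge> 2 / 3\<close>. This is the source of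
      \<open>4 ^ K\<close>.\<close>
    then show "(\<Prod>p\<in>P. 1 + ?s p) \<le> 4 * L" using L \<epsilon> by simp
  qed (auto intro!: prod_nonneg add_nonneg_nonneg zero_le_power)
  finally have bound: "(\<Prod>p\<in>P. 1 + \<bar>h p\<bar> * real p powr (-\<epsilon>))
      \<le> real (num_squarefree_divisors w) * (4 * L) ^ K" .
  have "real n powr \<epsilon> * (\<Prod>p\<in>P. 1 + \<bar>h p\<bar> * real p powr (-\<epsilon>))
      \<le> exp 1 * (real (num_squarefree_divisors w) * (4 * L) ^ K)"
    by (rule mult_mono[OF n\<epsilon> bound]) (simp_all add: prod_nonneg)
  moreover have "\<bar>(\<Sum>a=1..n. \<Prod>p\<in>{p\<in>P. p dvd a}. 1 + h p) - real n * (\<Prod>p\<in>P. 1 + h p / real p)\<bar>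
         \<le> real n powr \<epsilon> * (\<Prod>p\<in>P. 1 + \<bar>h p\<bar> * real p powr (-\<epsilon>))"
    by (rule sum_multiplicative_approx[OF assms(1,2)]) (use assms(3) \<epsilon> in auto)
  ultimately have "\<bar>(\<Sum>a=1..n. \<Prod>p\<in>{p\<in>P. p dvd a}. 1 + h p) - real n * (\<Prod>p\<in>P. 1 + h p / real p)\<bar>
      \<le> exp 1 * (real (num_squarefree_divisors w) * (4 * L) ^ K)"
    by linarith
  also have "\<dots> = exp 1 * 4 ^ K * real (num_squarefree_divisors w) * ln (real n) ^ K"
    by (simp add: L_def power_mult_distrib)
  finally show ?thesis .
qed

section \<open>Local densities\<close>

definition nbrs :: "nat set set \<Rightarrow> nat \<Rightarrow> nat set" where
  "nbrs E v = {w. {v, w} \<in> E}"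

text \<open>
  The probability that a random subset of \<open>V\<close>, containing each vertex independently with
  probability \<open>x\<close>, is independent in the graph and avoids \<open>S\<close>.  For \<open>x = 1 / p\<close> this is the density
  of the tuples satisfying all conditions at the prime \<open>p\<close>, if \<open>S\<close> is the set of \<open>i\<close> with \<open>p dvd u i\<close>.
\<close>

definition local_density :: "nat set set \<Rightarrow> real \<Rightarrow> nat set \<Rightarrow> nat set \<Rightarrow> real" where
  "local_density E x V S =
     (\<Sum>A | A \<subseteq> V \<and> indep A E \<and> A \<inter> S = {}. (1 - x) ^ (card V - card A) * x ^ card A)"

lemma local_density_empty [simp]: "local_density E x {} S = 1"
proof -
  have "{A. A \<subseteq> {} \<and> indep A E \<and> A \<inter> S = {}} = {{}}" by auto
  then show ?thesis by (simp add: local_density_def)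
qed

lemma local_density_cong:
  assumes "S \<inter> V = S' \<inter> V"
  shows "local_density E x V S = local_density E x V S'"
  unfolding local_density_def by (rule sum.cong) (use assms in blast)+

section \<open>Recursion over the vertices and bounds for the densities\<close>

lemma indep_insert_iff:
  "v \<notin> B \<Longrightarrow> indep (insert v B) E \<longleftrightarrow> indep B E \<and> B \<inter> nbrs E v = {}"
  unfolding indep_def nbrs_def by (auto simp: insert_commute)

text \<open>The random set either omits \<open>v\<close>, with weight \<open>1 - x\<close>, or
  contains it, with weight \<open>x\<close>; in the second case \<open>v\<close> must lie outside
  \<open>S\<close> and the rest must also avoid the neighbours of \<open>v\<close>. This mirrors
  fixing the coordinate at \<open>v\<close> of a tuple.\<close>

lemma local_density_insert:
  assumes "finite V" "v \<notin> V"
  shows "local_density E x (insert v V) S =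
    (1 - x) * local_density E x V S +
    (if v \<in> S then 0 else x * local_density E x V (S \<union> nbrs E v))"
proof -
  define I where "I S = {A. A \<subseteq> V \<and> indep A E \<and> A \<inter> S = {}}" for S
  define J where "J = (if v \<in> S then {} else insert v ` I (S \<union> nbrs E v))"
  define f where "f W A = (1 - x) ^ (card W - card A) * x ^ card A" for W A :: "nat set"
  have finI: "finite (I S)" for S
    unfolding I_def using assms(1) by (intro finite_subset[of "{A. A \<subseteq> V \<and> indep A E \<and> A \<inter> S = {}}" "Pow V"]) auto
  have sub: "finite A" "card A \<le> card V" "v \<notin> A" if "A \<in> I S" for A S
    using that assms by (auto simp: I_def intro: finite_subset card_mono)
  have "{A. A \<subseteq> insert v V \<and> indep A E \<and> A \<inter> S = {}} = I S \<union> J"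
  proof (intro set_eqI iffI)
    fix A assume A: "A \<in> {A. A \<subseteq> insert v V \<and> indep A E \<and> A \<inter> S = {}}"
    show "A \<in> I S \<union> J"
    proof (cases "v \<in> A")
      case True
      then obtain B where B: "A = insert v B" "v \<notin> B"
        by (meson Set.set_insert)
      with A assms(2) have "B \<in> I (S \<union> nbrs E v)" "v \<notin> S"
        by (auto simp: I_def indep_insert_iff)
      with B show ?thesis by (auto simp: J_def)
    next
      case False
      with A show ?thesis by (auto simp: I_def)
    qed
  next
    fix A assume "A \<in> I S \<union> J"
    then show "A \<in> {A. A \<subseteq> insert v V \<and> indep A E \<and> A \<inter> S = {}}"
    proof
      assume "A \<in> J"
      then obtain B where B: "A = insert v B" "B \<in> I (S \<union> nbrs E v)" "v \<notin> S"
        by (auto simp: J_def split: if_splits)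
      with sub(3)[OF B(2)] show ?thesis
        by (auto simp: I_def indep_insert_iff)
    qed (auto simp: I_def)
  qed
  then have "local_density E x (insert v V) S = sum (f (insert v V)) (I S \<union> J)"
    by (simp add: local_density_def f_def)
  also have "\<dots> = sum (f (insert v V)) (I S) + sum (f (insert v V)) J"
  proof (rule sum.union_disjoint)
    show "I S \<inter> J = {}"
      using sub(3) by (auto simp: J_def)
  qed (use finI in \<open>auto simp: J_def\<close>)
  also have "sum (f (insert v V)) (I S) = (1 - x) * sum (f V) (I S)"
    unfolding sum_distrib_left
    by (rule sum.cong) (use assms sub in \<open>auto simp: f_def Suc_diff_le\<close>)
  also have "sum (f (insert v V)) J = (if v \<in> S then 0 else x * sum (f V) (I (S \<union> nbrs E v)))"
  proof (cases "v \<in> S")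
    case False
    have "inj_on (insert v) (I (S \<union> nbrs E v))"
      using sub(3) by (intro inj_onI) (metis insert_ident)
    then have "sum (f (insert v V)) J = (\<Sum>B\<in>I (S \<union> nbrs E v). f (insert v V) (insert v B))"
      using False by (simp add: J_def sum.reindex)
    also have "\<dots> = (\<Sum>B\<in>I (S \<union> nbrs E v). x * f V B)"
      by (rule sum.cong) (use assms sub in \<open>auto simp: f_def\<close>)
    finally show ?thesis using False by (simp add: sum_distrib_left)
  qed (simp add: J_def)
  finally show ?thesis by (simp add: local_density_def f_def I_def)
qed

context
  fixes E :: "nat set set" and x :: real
  assumes x: "0 < x" "x < 1"
begin

lemma local_density_pos: "finite V \<Longrightarrow> local_density E x V S > 0"
proof (induction V arbitrary: S rule: finite_induct)
  case (insert v V)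
  then show ?case
    using x by (auto simp: local_density_insert intro!: add_pos_nonneg mult_pos_pos mult_nonneg_nonneg less_imp_le)
qed simp

lemma local_density_antimono:
  assumes "finite V" "S \<subseteq> S'"
  shows "local_density E x V S' \<le> local_density E x V S"
  unfolding local_density_def
  using assms x by (intro sum_mono2) (auto intro: finite_subset[of _ "Pow V"])

lemma local_density_le_1: "finite V \<Longrightarrow> local_density E x V S \<le> 1"
proof (induction V arbitrary: S rule: finite_induct)
  case (insert v V)
  have "(1 - x) * local_density E x V S \<le> 1 - x"
    using x insert mult_left_le[of "local_density E x V S" "1 - x"] by simp
  moreover have "(if v \<in> S then 0 else x * local_density E x V (S \<union> nbrs E v)) \<le> x"
    using x insert by simp
  ultimately show ?case
    unfolding local_density_insert[OF insert.hyps(1,2)] by linarith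
qed simp

text \<open>What is lost are the independent sets containing \<open>i\<close>. Their weight is
  \<open>x\<close> times a density on the other vertices that is at most the original one. The loss
  is bounded relative to the density so that one can divide by it later.\<close>

lemma local_density_insert_diff_le:
  assumes "finite V"
  shows "local_density E x V S - local_density E x V (insert i S) \<le> x * local_density E x V S"
proof (cases "i \<in> V \<and> i \<notin> S")
  case True
  define W where "W = V - {i}"
  have W: "finite W" "i \<notin> W" "V = insert i W"
    using True assms by (auto simp: W_def)
  have eq: "local_density E x W (insert i S) = local_density E x W S"
    using W(2) by (intro local_density_cong) auto
  have "local_density E x V S - local_density E x V (insert i S) = x * local_density E x W (S \<union> nbrs E i)"
    using True W(1,2) by (simp add: W(3) local_density_insert eq)
  also have "\<dots> \<le> x * local_density E x V S"
  proof (rule mult_left_mono)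
    \<comment> \<open>By the recursion at \<open>i\<close>, the density on \<open>V\<close> is
      \<open>1 - x\<close> times that on \<open>W\<close> avoiding \<open>S\<close>, plus
      \<open>x\<close> times the left-hand side of the goal; so only the first part has to be
      compared.\<close>
    have "(1 - x) * local_density E x W (S \<union> nbrs E i) \<le> (1 - x) * local_density E x W S"
      using x W(1) by (intro mult_left_mono local_density_antimono) auto
    then show "local_density E x W (S \<union> nbrs E i) \<le> local_density E x V S"
      using True W(1,2) by (simp add: W(3) local_density_insert algebra_simps)
  qed (use x in auto)
  finally show ?thesis .
next
  case False
  then have "local_density E x V (insert i S) = local_density E x V S"
    by (intro local_density_cong) auto
  then show ?thesis
    using x local_density_pos[OF assms, of S] by simp
qed

text \<open>The vertices of \<open>N\<close> are forbidden one at a time, and only those in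
  \<open>V\<close> have an effect, whence the factor \<open>card V\<close>. This estimate yields
  \<open>h p = O(1 / p)\<close>.\<close>

lemma local_density_Un_diff_le:
  assumes "finite V"
  shows "local_density E x V S - local_density E x V (S \<union> N) \<le> real (card V) * x * local_density E x V S"
proof -
  have *: "local_density E x V S - local_density E x V (S \<union> N) \<le> real (card N) * x * local_density E x V S"
    if "finite N" for N
    using that
  proof (induction N rule: finite_induct)
    case (insert i N)
    have "local_density E x V (S \<union> N) - local_density E x V (insert i (S \<union> N))
        \<le> x * local_density E x V (S \<union> N)"
      using assms by (rule local_density_insert_diff_le)
    also have "\<dots> \<le> x * local_density E x V S"
      using x assms by (intro mult_left_mono local_density_antimono) auto
    finally show ?case
      using insert by (simp add: algebra_simps)
  qed simp
  have "local_density E x V (S \<union> N) = local_density E x V (S \<union> (N \<inter> V))"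
    by (rule local_density_cong) auto
  moreover have "real (card (N \<inter> V)) * x * local_density E x V S \<le> real (card V) * x * local_density E x V S"
    using x assms local_density_pos[OF assms, of S]
    by (intro mult_right_mono) (auto intro!: card_mono)
  ultimately show ?thesis
    using *[of "N \<inter> V"] assms by auto
qed

text \<open>Adding \<open>v\<close> costs \<open>x\<close> times the loss from forbidding its
  neighbours, which is itself \<open>O(x)\<close>. The resulting second order in
  \<open>x = 1 / p\<close> makes the product over all primes converge.\<close>

lemma one_minus_local_density_le:
  assumes "finite V"
  shows "1 - local_density E x V {} \<le> (real (card V))\<^sup>2 * x\<^sup>2"
  using assms
proof (induction V rule: finite_induct)
  case (insert v V)
  let ?D = "local_density E x V {}"
  have "1 - local_density E x (insert v V) {} = (1 - ?D) + x * (?D - local_density E x V ({} \<union> nbrs E v))"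
    using insert by (simp add: local_density_insert algebra_simps)
  also have "\<dots> \<le> (real (card V))\<^sup>2 * x\<^sup>2 + x * (real (card V) * x * 1)"
  proof (intro add_mono mult_left_mono)
    have "?D - local_density E x V ({} \<union> nbrs E v) \<le> real (card V) * x * ?D"
      using insert.hyps(1) by (rule local_density_Un_diff_le)
    also have "\<dots> \<le> real (card V) * x * 1"
      using x local_density_le_1[OF insert.hyps(1)] by (intro mult_left_mono) auto
    finally show "?D - local_density E x V ({} \<union> nbrs E v) \<le> real (card V) * x * 1" .
  qed (use insert x in auto)
  \<comment> \<open>With \<open>m = card V\<close> this is
    \<open>m^2 + m \<le> (m + 1)^2\<close>.\<close>
  also have "\<dots> \<le> (real (card (insert v V)))\<^sup>2 * x\<^sup>2"
    using insert x by (simp add: power2_eq_square algebra_simps)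
  finally show ?case .
qed simp

end

section \<open>Translation of the sums over \<open>m\<close> into densities\<close>

lemma local_density_scaled:
  assumes "finite V" "p > 0"
  shows "local_density E (1 / p) V S =
    (\<Sum>A | A \<subseteq> V \<and> indep A E \<and> A \<inter> S = {}. (p - 1) ^ (card V - card A)) / p ^ card V"
  unfolding local_density_def sum_divide_distrib
proof (intro sum.cong refl)
  fix A assume "A \<in> {A. A \<subseteq> V \<and> indep A E \<and> A \<inter> S = {}}"
  then have "card A \<le> card V" using assms(1) by (auto intro: card_mono)
  then have *: "p ^ card V = p ^ (card V - card A) * p ^ card A"
    by (simp flip: power_add)
  have "1 - 1 / p = (p - 1) / p" using assms(2) by (simp add: field_simps)
  then show "(1 - 1 / p) ^ (card V - card A) * (1 / p) ^ card A = (p - 1) ^ (card V - card A) / p ^ card V"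
    by (simp add: * power_divide)
qed

lemma sum_card_eq_mult:
  fixes g :: "nat \<Rightarrow> real"
  assumes "finite I" "\<And>A. A \<in> I \<Longrightarrow> card A \<le> k"
  shows "(\<Sum>m=0..k. real (card {A \<in> I. card A = m}) * g m) = (\<Sum>A\<in>I. g (card A))"
proof -
  have "(\<Sum>m=0..k. real (card {A \<in> I. card A = m}) * g m) = (\<Sum>m=0..k. \<Sum>A\<in>{A \<in> I. card A = m}. g (card A))"
    by (intro sum.cong refl) simp
  also have "\<dots> = (\<Sum>A\<in>I. g (card A))"
    by (rule sum.group) (use assms in auto)
  finally show ?thesis .
qed

lemma finite_indep: "finite {A. A \<subseteq> {1..k::nat} \<and> indep A E}"
  by (rule finite_subset[of _ "Pow {1..k}"]) auto

lemma card_subset_le: "A \<subseteq> {1..k::nat} \<Longrightarrow> card A \<le> k"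
  using card_mono[of "{1..k}" A] by simp

lemma sum_num_indep:
  fixes g :: "nat \<Rightarrow> real"
  shows "(\<Sum>m=0..k. real (num_indep k E m) * g m) = (\<Sum>A | A \<subseteq> {1..k} \<and> indep A E. g (card A))"
proof -
  have "num_indep k E m = card {A \<in> {A. A \<subseteq> {1..k} \<and> indep A E}. card A = m}" for m
    unfolding num_indep_def indep_sets_def by (rule arg_cong[where f = card]) auto
  then show ?thesis
    using sum_card_eq_mult[OF finite_indep card_subset_le, of k E k g] by simp
qed

lemma sum_num_indep_meeting:
  fixes g :: "nat \<Rightarrow> real"
  shows "(\<Sum>m=0..k. real (num_indep_meeting k E m S) * g m)
    = (\<Sum>A | A \<subseteq> {1..k} \<and> indep A E \<and> A \<inter> S \<noteq> {}. g (card A))"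
proof -
  let ?I = "{A. A \<subseteq> {1..k} \<and> indep A E \<and> A \<inter> S \<noteq> {}}"
  have "num_indep_meeting k E m S = card {A \<in> ?I. card A = m}" for m
    unfolding num_indep_meeting_def indep_sets_def by (rule arg_cong[where f = card]) auto
  moreover have "finite ?I"
    by (rule finite_subset[OF _ finite_indep]) auto
  ultimately show ?thesis
    using sum_card_eq_mult[of ?I k g] card_subset_le by simp
qed

lemma density_factor_prime:
  "prime p \<Longrightarrow> density_factor k E p = local_density E (1 / real p) {1..k} {}"
  using sum_num_indep[where g = "\<lambda>m. (1 - 1 / real p) ^ (k - m) * (1 / real p ^ m)"]
  by (simp add: density_factor_def local_density_def power_one_over mult.assoc)

text \<open>Numerator and denominator are sums over independent sets, scaled by
  \<open>p ^ k\<close>. Subtracting the sets that meet \<open>S\<close> leaves those that avoid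
  it.\<close>

lemma local_correction_factor:
  assumes "prime p"
  shows "1 - (\<Sum>m=0..k. real (num_indep_meeting k E m S) * (real p - 1) ^ (k - m)) /
            (\<Sum>m=0..k. real (num_indep k E m) * (real p - 1) ^ (k - m))
    = local_density E (1 / real p) {1..k} S / local_density E (1 / real p) {1..k} {}"
proof -
  define g where "g = (\<lambda>A :: nat set. (real p - 1) ^ (k - card A))"
  have p: "real p > 1" using prime_gt_1_nat[OF assms] by simp
  let ?I = "{A. A \<subseteq> {1..k} \<and> indep A E}"
  let ?M = "{A. A \<subseteq> {1..k} \<and> indep A E \<and> A \<inter> S \<noteq> {}}"
  let ?J = "{A. A \<subseteq> {1..k} \<and> indep A E \<and> A \<inter> S = {}}"
  have "sum g ?I = sum g (?M \<union> ?J)"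
    by (rule sum.cong) auto
  also have "\<dots> = sum g ?M + sum g ?J"
    by (rule sum.union_disjoint) (auto intro: finite_subset[OF _ finite_indep[of k E]])
  finally have split: "sum g ?I = sum g ?M + sum g ?J" .
  have dens: "local_density E (1 / real p) {1..k} {} = sum g ?I / real p ^ k"
    "local_density E (1 / real p) {1..k} S = sum g ?J / real p ^ k"
    using p by (simp_all add: local_density_scaled g_def)
  have "local_density E (1 / real p) {1..k} {} > 0"
    using p by (intro local_density_pos) auto
  then have "sum g ?I / real p ^ k > 0" by (simp only: dens)
  with p have "sum g ?I > 0" by (simp add: zero_less_divide_iff)
  with p have "1 - sum g ?M / sum g ?I = (sum g ?J / real p ^ k) / (sum g ?I / real p ^ k)"
    using split by (simp add: field_simps)
  then show ?thesis
    by (simp only: sum_num_indep sum_num_indep_meeting dens g_def)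
qed

section \<open>Counting tuples\<close>

text \<open>The vertex set is a parameter so that the induction can run over it. Edges leaving
  \<open>V\<close> impose nothing here; their effect is carried by \<open>u\<close>.\<close>

definition tuples :: "nat set set \<Rightarrow> nat set \<Rightarrow> (nat \<Rightarrow> nat) \<Rightarrow> nat \<Rightarrow> (nat \<Rightarrow> nat) set" where
  "tuples E V u n = {a \<in> V \<rightarrow>\<^sub>E {1..n}.
     (\<forall>i\<in>V. coprime (a i) (u i)) \<and> (\<forall>i\<in>V. \<forall>j\<in>V. {i, j} \<in> E \<longrightarrow> coprime (a i) (a j))}"

definition absorb :: "nat set set \<Rightarrow> nat \<Rightarrow> nat \<Rightarrow> (nat \<Rightarrow> nat) \<Rightarrow> nat \<Rightarrow> nat" where
  "absorb E v b u = (\<lambda>i. if i \<in> nbrs E v then u i * b else u i)"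

lemma finite_tuples: "finite V \<Longrightarrow> finite (tuples E V u n)"
  unfolding tuples_def by (rule finite_subset[of _ "V \<rightarrow>\<^sub>E {1..n}"]) (auto intro: finite_PiE)

text \<open>Being coprime to \<open>u i\<close> and to \<open>b\<close> is the same as being coprime
  to \<open>u i * b\<close>. A loop at \<open>v\<close> would demand that \<open>b\<close> be
  coprime to itself, hence the second assumption.\<close>

lemma fun_upd_in_tuples_iff:
  assumes "v \<notin> V" "{v} \<notin> E" "a \<in> V \<rightarrow>\<^sub>E {1..n}" "b \<in> {1..n}"
  shows "a(v := b) \<in> tuples E (insert v V) u n \<longleftrightarrow> coprime b (u v) \<and> a \<in> tuples E V (absorb E v b u) n"
proof -
  have *: "{v, i} \<in> E \<longleftrightarrow> i \<in> nbrs E v" "{i, v} \<in> E \<longleftrightarrow> i \<in> nbrs E v" for i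
    by (auto simp: nbrs_def insert_commute)
  have irrefl: "v \<notin> nbrs E v" using assms(2) by (simp add: nbrs_def)
  have ne: "i \<noteq> v" if "i \<in> V" for i using that assms(1) by auto
  have "a(v := b) \<in> insert v V \<rightarrow>\<^sub>E {1..n}"
    using assms(4,3) by (rule PiE_fun_upd)
  then have "a(v := b) \<in> tuples E (insert v V) u n \<longleftrightarrow>
      coprime b (u v) \<and> (\<forall>i\<in>V. coprime (a i) (u i)) \<and>
      (\<forall>i\<in>V. i \<in> nbrs E v \<longrightarrow> coprime (a i) b) \<and>
      (\<forall>i\<in>V. \<forall>j\<in>V. {i, j} \<in> E \<longrightarrow> coprime (a i) (a j))"
    using irrefl ne by (simp add: tuples_def * coprime_commute cong: ball_cong) (auto simp: coprime_commute)
  also have "\<dots> \<longleftrightarrow> coprime b (u v) \<and> a \<in> tuples E V (absorb E v b u) n"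
    using assms(3) by (auto simp: tuples_def absorb_def)
  finally show ?thesis .
qed

lemma card_tuples_insert:
  assumes "finite V" "v \<notin> V" "{v} \<notin> E"
  shows "card (tuples E (insert v V) u n) =
    (\<Sum>b=1..n. if coprime b (u v) then card (tuples E V (absorb E v b u) n) else 0)"
proof -
  define T where "T b = (if coprime b (u v) then tuples E V (absorb E v b u) n else {})" for b
  have sub: "T b \<subseteq> V \<rightarrow>\<^sub>E {1..n}" for b
    by (auto simp: T_def tuples_def)
  have "bij_betw (\<lambda>(b, a). a(v := b)) (SIGMA b:{1..n}. T b) (tuples E (insert v V) u n)"
  \<comment> \<open>Functions in the extensional function space over \<open>V\<close> are
    \<open>undefined\<close> outside \<open>V\<close>, so the coordinate at \<open>v\<close> is
    removed by resetting it to \<open>undefined\<close>.\<close>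
  proof (rule bij_betw_byWitness[where f' = "\<lambda>f. (f v, f(v := undefined))"])
    have "a v = undefined" if "a \<in> V \<rightarrow>\<^sub>E {1..n}" for a :: "nat \<Rightarrow> nat"
      using that assms(2) by (rule PiE_arb)
    then have "a(v := undefined) = a" if "a \<in> T b" for a b
      using that sub[of b] by (auto simp: fun_upd_idem)
    then show "\<forall>z\<in>(SIGMA b:{1..n}. T b).
        (\<lambda>f. (f v, f(v := undefined))) ((\<lambda>(b, a). a(v := b)) z) = z"
      by auto
    show "(\<lambda>(b, a). a(v := b)) ` (SIGMA b:{1..n}. T b) \<subseteq> tuples E (insert v V) u n"
    proof safe
      fix b a assume b: "b \<in> {1..n}" and a: "a \<in> T b"
      then show "a(v := b) \<in> tuples E (insert v V) u n"
        using fun_upd_in_tuples_iff[OF assms(2,3) _ b, of a] sub[of b]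
        by (auto simp: T_def split: if_splits)
    qed
    show "(\<lambda>f. (f v, f(v := undefined))) ` tuples E (insert v V) u n \<subseteq> (SIGMA b:{1..n}. T b)"
    proof
      fix z assume "z \<in> (\<lambda>f. (f v, f(v := undefined))) ` tuples E (insert v V) u n"
      then obtain f where f: "f \<in> tuples E (insert v V) u n" "z = (f v, f(v := undefined))" by blast
      then have f': "f \<in> insert v V \<rightarrow>\<^sub>E {1..n}" by (simp add: tuples_def)
      then have "f v \<in> {1..n}" by (rule PiE_mem) simp
      moreover have "f(v := undefined) \<in> V \<rightarrow>\<^sub>E {1..n}"
        using assms(2) f' by (rule fun_upd_in_PiE)
      ultimately show "z \<in> (SIGMA b:{1..n}. T b)"
        using fun_upd_in_tuples_iff[OF assms(2,3), of "f(v := undefined)" n "f v" u] f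
        by (simp add: T_def)
    qed
  qed simp
  then have "card (tuples E (insert v V) u n) = card (SIGMA b:{1..n}. T b)"
    by (simp add: bij_betw_same_card)
  also have "\<dots> = (\<Sum>b=1..n. card (T b))"
    using assms(1) by (intro card_SigmaI) (auto simp: T_def finite_tuples)
  also have "\<dots> = (\<Sum>b=1..n. if coprime b (u v) then card (tuples E V (absorb E v b u) n) else 0)"
    by (intro sum.cong) (auto simp: T_def)
  finally show ?thesis .
qed

text \<open>A finite Euler product: the density of the tuples satisfying all conditions at the
  primes of \<open>P\<close>.\<close>

definition partial_density :: "nat set set \<Rightarrow> nat set \<Rightarrow> nat set \<Rightarrow> (nat \<Rightarrow> nat) \<Rightarrow> real" where
  "partial_density E P V u = (\<Prod>p\<in>P. local_density E (1 / real p) V {i. p dvd u i})"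

lemma prime_inverse_bounds: "prime (p::nat) \<Longrightarrow> 0 < 1 / real p \<and> 1 / real p < 1"
  using prime_gt_1_nat[of p] by simp

text \<open>At a prime dividing \<open>b\<close> the forbidden set grows by the neighbours of
  \<open>v\<close>, which multiplies the local factor by \<open>1 + h p\<close>. If \<open>b\<close>
  and \<open>u v\<close> share a prime, it is at most \<open>n\<close>, hence in \<open>P\<close>,
  and its factor \<open>1 + h p = 0\<close> expresses the coprimality condition.\<close>

lemma partial_density_absorb:
  fixes E :: "nat set set" and V P :: "nat set" and u :: "nat \<Rightarrow> nat" and v b n :: nat
  assumes "finite V" "finite P" "\<And>p. p \<in> P \<Longrightarrow> prime p"
    and "\<And>p. prime p \<Longrightarrow> p \<le> n \<Longrightarrow> p \<in> P" "b \<in> {1..n}"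
  defines "D \<equiv> \<lambda>p S. local_density E (1 / real p) V S"
  defines "S \<equiv> \<lambda>p. {i. p dvd u i}"
  defines "h \<equiv> \<lambda>p. if p dvd u v then -1 else D p (S p \<union> nbrs E v) / D p (S p) - 1"
  shows "(if coprime b (u v) then partial_density E P V (absorb E v b u) else 0)
    = partial_density E P V u * (\<Prod>p\<in>{p\<in>P. p dvd b}. 1 + h p)"
proof (cases "coprime b (u v)")
  case True
  have nz: "D p T \<noteq> 0" if "p \<in> P" for p T
    using local_density_pos[of "1 / real p" V E T] prime_inverse_bounds[OF assms(3)[OF that]] assms(1)
    by (simp add: D_def)
  have "partial_density E P V (absorb E v b u) = (\<Prod>p\<in>P. D p (S p) * (if p dvd b then 1 + h p else 1))"
    unfolding partial_density_def
  proof (rule prod.cong)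
    fix p assume p: "p \<in> P"
    then have "prime p" by (rule assms(3))
    then have set: "{i. p dvd absorb E v b u i} = (if p dvd b then S p \<union> nbrs E v else S p)"
      by (auto simp: absorb_def S_def prime_dvd_mult_iff)
    have "\<not> p dvd u v" if "p dvd b"
      using True that \<open>prime p\<close> by (metis coprime_common_divisor not_prime_unit)
    then show "local_density E (1 / real p) V {i. p dvd absorb E v b u i}
        = D p (S p) * (if p dvd b then 1 + h p else 1)"
      using nz[OF p] by (simp add: set h_def D_def)
  qed simp
  also have "\<dots> = partial_density E P V u * (\<Prod>p\<in>{p\<in>P. p dvd b}. 1 + h p)"
    using assms(2) by (simp add: partial_density_def D_def S_def prod.distrib prod.inter_filter)
  finally show ?thesis using True by simp
next
  case False
  then obtain q where q: "prime q" "q dvd b" "q dvd u v"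
    by (metis coprime_iff_gcd_eq_1 prime_factor_nat gcd_greatest_iff)
  with assms(5) have "q \<le> n" by (auto dest: dvd_imp_le)
  with q assms(4) have "q \<in> {p\<in>P. p dvd b}" "1 + h q = 0" by (auto simp: h_def)
  then have "(\<Prod>p\<in>{p\<in>P. p dvd b}. 1 + h p) = 0"
    using assms(2) by (intro prod_zero) auto
  with False show ?thesis by simp
qed

text \<open>
  The bound is uniform in the set \<open>P\<close>, so it survives the passage to all primes.  It is written with
  \<open>X ^ k / X\<close> instead of \<open>X ^ (k - 1)\<close>, for \<open>X = n ln n\<close>, to let the induction start at \<open>V = {}\<close>.
\<close>

proposition card_tuples_approx:
  assumes "finite V" and "\<And>v. {v} \<notin> E"
  shows "\<exists>C\<ge>0. \<forall>n u \<Theta> P. n \<ge> 2 \<longrightarrow>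
    (\<forall>i\<in>V. u i > 0 \<and> real (num_squarefree_divisors (u i)) \<le> \<Theta>) \<longrightarrow> 1 \<le> \<Theta> \<longrightarrow>
    finite P \<longrightarrow> (\<forall>p\<in>P. prime p) \<longrightarrow> (\<forall>p. prime p \<longrightarrow> p \<le> n \<longrightarrow> p \<in> P) \<longrightarrow>
    \<bar>real (card (tuples E V u n)) - real n ^ card V * partial_density E P V u\<bar>
      \<le> C * \<Theta> * (real n * ln (real n)) ^ card V / (real n * ln (real n))"
  using assms(1)
proof (induction V rule: finite_induct)
  case empty
  then show ?case
    by (intro exI[of _ 0]) (simp add: tuples_def partial_density_def)
next
  case (insert v V)
  then obtain C where C: "C \<ge> 0" and IH: "\<And>n u \<Theta> P. n \<ge> 2 \<Longrightarrow>
    (\<forall>i\<in>V. u i > 0 \<and> real (num_squarefree_divisors (u i)) \<le> \<Theta>) \<Longrightarrow> 1 \<le> \<Theta> \<Longrightarrow>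
    finite P \<Longrightarrow> (\<forall>p\<in>P. prime p) \<Longrightarrow> (\<forall>p. prime p \<longrightarrow> p \<le> n \<longrightarrow> p \<in> P) \<Longrightarrow>
    \<bar>real (card (tuples E V u n)) - real n ^ card V * partial_density E P V u\<bar>
      \<le> C * \<Theta> * (real n * ln (real n)) ^ card V / (real n * ln (real n))"
    by metis
  define k where "k = card V"
  define c :: real where "c = exp 1 * 4 ^ k"
  show ?case
  \<comment> \<open>\<open>3 * C\<close> covers the inductive errors summed over \<open>b\<close>,
    since \<open>n * (1 + ln n) \<le> 3 * n * ln n\<close>; \<open>c\<close> covers the error in
    averaging the main terms.\<close>
  proof (intro exI[of _ "3 * C + c"] conjI allI impI)
    show "0 \<le> 3 * C + c" using C by (simp add: c_def)
    fix n :: nat and u and \<Theta> :: real and P :: "nat set"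
    assume n: "n \<ge> 2" and u: "\<forall>i\<in>insert v V. u i > 0 \<and> real (num_squarefree_divisors (u i)) \<le> \<Theta>"
      and \<Theta>: "1 \<le> \<Theta>" and P: "finite P" "\<forall>p\<in>P. prime p" "\<forall>p. prime p \<longrightarrow> p \<le> n \<longrightarrow> p \<in> P"
    define L where "L = ln (real n)"
    define X where "X = real n * L"
    have "ln 2 \<le> L" using n by (simp add: L_def)
    then have L: "2 / 3 \<le> L" using ln2_ge_two_thirds by linarith
    have X: "X > 0" using L n by (simp add: X_def)
    define M where "M b = partial_density E P V (absorb E v b u)" for b
    define M0 where "M0 = partial_density E P V u"
    define T where "T b = real (card (tuples E V (absorb E v b u) n))" for b
    define D where "D p S = local_density E (1 / real p) V S" for p S
    define S where "S p = {i. p dvd u i}" for p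
    define h where "h p = (if p dvd u v then -1 else D p (S p \<union> nbrs E v) / D p (S p) - 1)" for p
    have Dpos: "D p A > 0" and D1: "D p A \<le> 1" if "p \<in> P" for p A
      using local_density_pos[of "1 / real p" V E A] local_density_le_1[of "1 / real p" V E A]
        prime_inverse_bounds[of p] that P insert.hyps(1)
      by (auto simp: D_def)
    have M0: "0 \<le> M0" "M0 \<le> 1"
      using less_imp_le[OF Dpos] D1 unfolding M0_def partial_density_def D_def
      by (auto intro!: prod_nonneg prod_le_1)

    have count: "real (card (tuples E (insert v V) u n)) = (\<Sum>b=1..n. if coprime b (u v) then T b else 0)"
      using card_tuples_insert[OF insert.hyps assms(2)] by (simp add: T_def if_distrib[of real] cong: if_cong)
    \<comment> \<open>First error: each count is replaced by its main term.\<close>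
    have "\<bar>(\<Sum>b=1..n. if coprime b (u v) then T b else 0) -
             real n ^ k * (\<Sum>b=1..n. if coprime b (u v) then M b else 0)\<bar>
        \<le> (\<Sum>b=1..n. \<bar>(if coprime b (u v) then T b else 0) - real n ^ k * (if coprime b (u v) then M b else 0)\<bar>)"
      unfolding sum_distrib_left sum_subtractf[symmetric] by (rule sum_abs)
    also have "\<dots> \<le> (\<Sum>b=1..n. C * (\<Theta> * real (num_squarefree_divisors b)) * X ^ k / X)"
    proof (rule sum_mono)
      fix b assume b: "b \<in> {1..n}"
      let ?\<theta> = "real (num_squarefree_divisors b)"
      have \<theta>: "1 \<le> ?\<theta>" using num_squarefree_divisors_ge_1[of b] b by simp
      \<comment> \<open>By submultiplicativity the induction hypothesis applies to the absorbed
        tuple with \<open>\<Theta> * \<theta> b\<close> in place of \<open>\<Theta>\<close>.\<close>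
      have "absorb E v b u i > 0 \<and> real (num_squarefree_divisors (absorb E v b u i)) \<le> \<Theta> * ?\<theta>"
        if "i \<in> V" for i
      proof (cases "i \<in> nbrs E v")
        case True
        have ui: "u i > 0" "real (num_squarefree_divisors (u i)) \<le> \<Theta>" using u that by auto
        have "num_squarefree_divisors (u i * b) \<le> num_squarefree_divisors (u i) * num_squarefree_divisors b"
          using ui b by (intro num_squarefree_divisors_mult_le) auto
        then have "real (num_squarefree_divisors (u i * b)) \<le> real (num_squarefree_divisors (u i)) * ?\<theta>"
          by (metis of_nat_le_iff of_nat_mult)
        also have "\<dots> \<le> \<Theta> * ?\<theta>" using ui by (intro mult_right_mono) auto
        finally show ?thesis using True ui b by (simp add: absorb_def)
      next
        case False
        have "real (num_squarefree_divisors (u i)) \<le> \<Theta> * 1" using u that by simp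
        also have "\<dots> \<le> \<Theta> * ?\<theta>" using \<theta> \<Theta> by (intro mult_left_mono) auto
        finally show ?thesis using False u that by (simp add: absorb_def)
      qed
      moreover have "1 * 1 \<le> \<Theta> * ?\<theta>" using \<theta> \<Theta> by (intro mult_mono) auto
      ultimately have "\<bar>T b - real n ^ k * M b\<bar> \<le> C * (\<Theta> * ?\<theta>) * X ^ k / X"
        unfolding T_def M_def k_def X_def L_def by (intro IH n P ballI) simp_all
      moreover have "0 \<le> C * (\<Theta> * ?\<theta>) * X ^ k / X"
        using C \<Theta> X by simp
      ultimately show "\<bar>(if coprime b (u v) then T b else 0) - real n ^ k * (if coprime b (u v) then M b else 0)\<bar>
          \<le> C * (\<Theta> * ?\<theta>) * X ^ k / X"
        by simp
    qed
    also have "\<dots> = C * \<Theta> * X ^ k / X * (\<Sum>b=1..n. real (num_squarefree_divisors b))"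
      unfolding sum_distrib_left by (intro sum.cong refl) simp
    also have "\<dots> \<le> C * \<Theta> * X ^ k / X * (3 * X)"
    proof (rule mult_left_mono)
      have "(\<Sum>b=1..n. real (num_squarefree_divisors b)) \<le> real n * (1 + L)"
        using n unfolding L_def by (intro sum_num_squarefree_divisors_le) auto
      also have "\<dots> \<le> real n * (3 * L)"
        using L by (intro mult_left_mono) auto
      finally show "(\<Sum>b=1..n. real (num_squarefree_divisors b)) \<le> 3 * X"
        by (simp add: X_def)
    qed (use C \<Theta> X in simp)
    also have "\<dots> = 3 * C * \<Theta> * X ^ k"
      using X by simp
    finally have err1: "\<bar>(\<Sum>b=1..n. if coprime b (u v) then T b else 0) -
             real n ^ k * (\<Sum>b=1..n. if coprime b (u v) then M b else 0)\<bar> \<le> 3 * C * \<Theta> * X ^ k" .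

    have sumM: "(\<Sum>b=1..n. if coprime b (u v) then M b else 0) =
        M0 * (\<Sum>b=1..n. \<Prod>p\<in>{p\<in>P. p dvd b}. 1 + h p)"
      unfolding sum_distrib_left M_def M0_def h_def D_def S_def
      by (rule sum.cong, rule refl, rule partial_density_absorb[where n = n]) (use insert.hyps P in auto)
    \<comment> \<open>Second error: the main terms are averaged over \<open>b\<close>.\<close>
    have "\<bar>(\<Sum>b=1..n. \<Prod>p\<in>{p\<in>P. p dvd b}. 1 + h p) - real n * (\<Prod>p\<in>P. 1 + h p / real p)\<bar>
        \<le> exp 1 * 4 ^ k * real (num_squarefree_divisors (u v)) * ln (real n) ^ k"
    proof (rule sum_multiplicative_error)
      fix p assume p: "p \<in> P" "\<not> p dvd u v"
      have "D p (S p \<union> nbrs E v) \<le> D p (S p)"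
        unfolding D_def using prime_inverse_bounds[of p] p P insert.hyps(1)
        by (intro local_density_antimono) auto
      moreover have "D p (S p) - D p (S p \<union> nbrs E v) \<le> real k * (1 / real p) * D p (S p)"
        unfolding D_def k_def using prime_inverse_bounds[of p] p P insert.hyps(1)
        by (intro local_density_Un_diff_le) auto
      ultimately show "\<bar>h p\<bar> \<le> real k / real p"
        using p Dpos[OF p(1), of "S p"] by (simp add: h_def field_simps abs_le_iff)
    qed (use P n u in \<open>auto simp: h_def\<close>)
    also have "\<dots> \<le> c * \<Theta> * L ^ k"
      using u L unfolding c_def L_def by (intro mult_right_mono mult_left_mono) auto
    finally have "\<bar>(\<Sum>b=1..n. \<Prod>p\<in>{p\<in>P. p dvd b}. 1 + h p) - real n * (\<Prod>p\<in>P. 1 + h p / real p)\<bar>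
        \<le> c * \<Theta> * L ^ k" .
    then have "real n ^ k * M0 * \<bar>(\<Sum>b=1..n. \<Prod>p\<in>{p\<in>P. p dvd b}. 1 + h p) - real n * (\<Prod>p\<in>P. 1 + h p / real p)\<bar>
        \<le> real n ^ k * 1 * (c * \<Theta> * L ^ k)"
      using M0 \<Theta> by (intro mult_mono) auto
    also have "\<dots> = c * \<Theta> * X ^ k"
      by (simp add: X_def power_mult_distrib)
    finally have err2: "\<bar>real n ^ k * M0 * (\<Sum>b=1..n. \<Prod>p\<in>{p\<in>P. p dvd b}. 1 + h p) -
        real n ^ k * M0 * (real n * (\<Prod>p\<in>P. 1 + h p / real p))\<bar> \<le> c * \<Theta> * X ^ k"
      using M0 unfolding right_diff_distrib[symmetric] abs_mult by simp

    \<comment> \<open>Prime by prime, \<open>D * (1 + h p / p)\<close> is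
      \<open>(1 - 1 / p) * D\<close>, plus \<open>D' / p\<close> if \<open>p\<close> does not divide
      \<open>u v\<close>, where \<open>D'\<close> also forbids the neighbours of \<open>v\<close>.
      This is the recursion for the density at \<open>v\<close>.\<close>
    have "M0 * (\<Prod>p\<in>P. 1 + h p / real p) = partial_density E P (insert v V) u"
      unfolding M0_def partial_density_def prod.distrib[symmetric]
    proof (rule prod.cong)
      fix p assume p: "p \<in> P"
      have "real p > 0" using P p by (auto dest: prime_gt_0_nat)
      then show "local_density E (1 / real p) V {i. p dvd u i} * (1 + h p / real p) =
          local_density E (1 / real p) (insert v V) {i. p dvd u i}"
        using Dpos[OF p, of "S p"] unfolding local_density_insert[OF insert.hyps]
        by (simp add: h_def D_def S_def field_simps)
    qed simp
    then have "real n ^ k * M0 * (real n * (\<Prod>p\<in>P. 1 + h p / real p))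
        = real n ^ card (insert v V) * partial_density E P (insert v V) u"
      using insert.hyps by (simp add: k_def mult_ac)
    then have "\<bar>real (card (tuples E (insert v V) u n)) -
        real n ^ card (insert v V) * partial_density E P (insert v V) u\<bar> \<le> 3 * C * \<Theta> * X ^ k + c * \<Theta> * X ^ k"
      using err1 err2 unfolding count sumM by (simp add: mult.assoc)
    also have "\<dots> = (3 * C + c) * \<Theta> * X ^ card (insert v V) / X"
      using X insert.hyps by (simp add: k_def field_simps)
    finally show "\<bar>real (card (tuples E (insert v V) u n)) -
        real n ^ card (insert v V) * partial_density E P (insert v V) u\<bar>
      \<le> (3 * C + c) * \<Theta> * (real n * ln (real n)) ^ card (insert v V) / (real n * ln (real n))"
      unfolding X_def L_def .
  qed
qed

section \<open>Passage to the infinite product\<close>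

text \<open>The factors are positive and differ from 1 by at most \<open>k^2 / p^2\<close>, which is
  summable.\<close>

lemma convergent_prod_density_factor: "convergent_prod (density_factor k E)"
proof -
  have bounds: "0 < density_factor k E p" "density_factor k E p \<le> 1"
    "1 - density_factor k E p \<le> (real k)\<^sup>2 * (1 / real p ^ 2)" for p
  proof -
    have "0 < density_factor k E p \<and> density_factor k E p \<le> 1 \<and>
        1 - density_factor k E p \<le> (real k)\<^sup>2 * (1 / real p ^ 2)"
    proof (cases "prime p")
      case True
      then show ?thesis
        using local_density_pos[of "1 / real p" "{1..k}" E "{}"]
          local_density_le_1[of "1 / real p" "{1..k}" E "{}"]
          one_minus_local_density_le[of "1 / real p" "{1..k}" E]
          prime_inverse_bounds[OF True]
        by (simp add: density_factor_prime power_one_over)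
    qed (simp add: density_factor_def)
    then show "0 < density_factor k E p" "density_factor k E p \<le> 1"
      "1 - density_factor k E p \<le> (real k)\<^sup>2 * (1 / real p ^ 2)" by auto
  qed
  have "summable (\<lambda>p. \<bar>density_factor k E p - 1\<bar>)"
  proof (rule summable_comparison_test')
    show "summable (\<lambda>p. (real k)\<^sup>2 * (1 / real p ^ 2))"
      using inverse_power_summable[of 2, where ?'a = real]
      by (intro summable_mult) (simp add: divide_inverse)
    show "norm \<bar>density_factor k E p - 1\<bar> \<le> (real k)\<^sup>2 * (1 / real p ^ 2)" for p
      using bounds(2,3)[of p] by simp
  qed
  moreover have "density_factor k E p - 1 \<noteq> -1" for p
    using bounds(1)[of p] by simp
  ultimately have "convergent_prod (\<lambda>p. 1 + (density_factor k E p - 1))"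
    by (rule summable_imp_convergent_prod_real)
  then show ?thesis by simp
qed

text \<open>The bound on \<open>N\<close> ensures that every prime dividing some \<open>u i\<close>
  is at most \<open>N\<close>. At the other primes up to \<open>N\<close> the correction ratio is 1,
  so both products can be taken over the same set.\<close>

lemma partial_density_primes_eq:
  assumes "\<And>i. i \<in> {1..k} \<Longrightarrow> u i > 0" "(\<Prod>i=1..k. u i) \<le> N"
  shows "partial_density E {p. prime p \<and> p \<le> N} {1..k} u
    = (\<Prod>p\<le>N. density_factor k E p) * local_correction k E u"
proof -
  define D where "D p S = local_density E (1 / real p) {1..k} S" for p S
  define P where "P = {p::nat. prime p \<and> p \<le> N}"
  define U where "U = (\<Prod>i=1..k. u i)"
  have finP: "finite P" by (simp add: P_def)
  have "U > 0" unfolding U_def using assms(1) by (intro prod_pos) auto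
  then have "p \<le> N" if "p dvd U" for p
    using dvd_imp_le[OF that] assms(2) by (simp add: U_def)
  then have sub: "{p. prime p \<and> p dvd U} \<subseteq> P"
    by (auto simp: P_def)
  have nz: "D p {} \<noteq> 0" if "p \<in> P" for p
  proof -
    have "D p {} > 0"
      unfolding D_def using prime_inverse_bounds[of p] that by (intro local_density_pos) (auto simp: P_def)
    then show ?thesis by simp
  qed
  have S: "D p {i. p dvd u i} = D p (dvd_indices k u p)" for p
    unfolding D_def by (rule local_density_cong) (auto simp: dvd_indices_def)
  have "dvd_indices k u p = {}" if "p \<in> P" "\<not> p dvd U" for p
    using that by (auto simp: dvd_indices_def U_def prime_dvd_prod_iff P_def)
  then have "(\<Prod>p\<in>{p. prime p \<and> p dvd U}. D p (dvd_indices k u p) / D p {})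
      = (\<Prod>p\<in>P. D p (dvd_indices k u p) / D p {})"
    using nz sub finP by (intro prod.mono_neutral_left) (auto simp: P_def)
  then have "local_correction k E u = (\<Prod>p\<in>P. D p (dvd_indices k u p) / D p {})"
    by (simp add: local_correction_def local_correction_factor D_def U_def cong: prod.cong_simp)
  moreover have "(\<Prod>p\<le>N. density_factor k E p) = (\<Prod>p\<in>P. D p {})"
  proof (rule prod.mono_neutral_cong_right)
    show "density_factor k E p = D p {}" if "p \<in> P" for p
      using that by (simp add: P_def D_def density_factor_prime)
  qed (auto simp: P_def density_factor_def)
  ultimately have "(\<Prod>p\<le>N. density_factor k E p) * local_correction k E u
      = (\<Prod>p\<in>P. D p (dvd_indices k u p))"
    using nz by (simp flip: prod.distrib)
  moreover have "partial_density E P {1..k} u = (\<Prod>p\<in>P. D p {i. p dvd u i})"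
    by (simp only: partial_density_def D_def)
  ultimately show ?thesis
    by (simp only: S P_def)
qed

theorem theorem1:
  fixes k :: nat and E :: "nat set set"
  assumes "k \<ge> 1" and "E \<subseteq> [{1..k}]\<^bsup>2\<^esup>"
  shows "convergent_prod (density_factor k E) \<and>
    (\<exists>C::real. \<forall>n::nat. \<forall>u::nat \<Rightarrow> nat. n \<ge> 2 \<longrightarrow> (\<forall>i\<in>{1..k}. u i \<ge> 1) \<longrightarrow>
       \<bar>real (count_tuples k E u n) - density_const k E * local_correction k E u * real n ^ k\<bar>
         \<le> C * (real (max_squarefree_divisors k u) * real n ^ (k - 1) * ln (real n) ^ (k - 1)))"
proof
  show conv: "convergent_prod (density_factor k E)"
    by (rule convergent_prod_density_factor)
  have no_loop: "{v} \<notin> E" for v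
    using assms(2) by (auto simp: nsets_def)
  have edges: "i \<in> {1..k} \<and> j \<in> {1..k}" if "{i, j} \<in> E" for i j
    using assms(2) that by (auto simp: nsets_def)
  \<comment> \<open>Every edge lies inside \<open>{1..k}\<close>, so restricting \<open>i\<close>
    and \<open>j\<close> to vertices changes nothing.\<close>
  have count: "count_tuples k E u n = card (tuples E {1..k} u n)" for u n
    unfolding count_tuples_def tuples_def coprime_iff_gcd_eq_1
    by (rule arg_cong[where f = card]) (use edges in blast)
  obtain C where C: "\<And>n u \<Theta> P. n \<ge> 2 \<Longrightarrow>
    (\<forall>i\<in>{1..k}. u i > 0 \<and> real (num_squarefree_divisors (u i)) \<le> \<Theta>) \<Longrightarrow> 1 \<le> \<Theta> \<Longrightarrow>
    finite P \<Longrightarrow> (\<forall>p\<in>P. prime p) \<Longrightarrow> (\<forall>p. prime p \<longrightarrow> p \<le> n \<longrightarrow> p \<in> P) \<Longrightarrow>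
    \<bar>real (card (tuples E {1..k} u n)) - real n ^ card {1..k} * partial_density E P {1..k} u\<bar>
      \<le> C * \<Theta> * (real n * ln (real n)) ^ card {1..k} / (real n * ln (real n))"
    using card_tuples_approx[of "{1..k}" E] no_loop by (metis finite_atLeastAtMost)
  show "\<exists>C::real. \<forall>n::nat. \<forall>u::nat \<Rightarrow> nat. n \<ge> 2 \<longrightarrow> (\<forall>i\<in>{1..k}. u i \<ge> 1) \<longrightarrow>
       \<bar>real (count_tuples k E u n) - density_const k E * local_correction k E u * real n ^ k\<bar>
         \<le> C * (real (max_squarefree_divisors k u) * real n ^ (k - 1) * ln (real n) ^ (k - 1))"
  proof (intro exI[of _ C] allI impI)
    fix n :: nat and u :: "nat \<Rightarrow> nat"
    assume n: "n \<ge> 2" and u: "\<forall>i\<in>{1..k}. u i \<ge> 1"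
    define \<Theta> where "\<Theta> = real (max_squarefree_divisors k u)"
    define B where "B = C * (\<Theta> * real n ^ (k - 1) * ln (real n) ^ (k - 1))"
    define A where "A N = (\<Prod>p\<le>N. density_factor k E p)" for N
    have le_\<Theta>: "real (num_squarefree_divisors (u i)) \<le> \<Theta>" if "i \<in> {1..k}" for i
      using that by (auto simp: \<Theta>_def max_squarefree_divisors_def intro!: Max_ge)
    have "1 \<le> \<Theta>"
    proof -
      have one: "1 \<in> {1..k}" using assms(1) by simp
      with u have "num_squarefree_divisors (u 1) \<ge> 1"
        by (intro num_squarefree_divisors_ge_1) (auto simp: Suc_le_eq)
      with le_\<Theta>[OF one] show ?thesis by linarith
    qed
    have u': "u i > 0" if "i \<in> {1..k}" for i
      using bspec[OF u that] by simp
    have "\<bar>real (count_tuples k E u n) - real n ^ k * (A N * local_correction k E u)\<bar> \<le> B"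
      \<comment> \<open>\<open>N \<ge> n\<close> supplies all primes up to \<open>n\<close> for the
        counting estimate; \<open>N\<close> at least the product supplies all primes dividing it for
        the correction.\<close>
      if N: "N \<ge> max n (\<Prod>i=1..k. u i)" for N
    proof -
      have "\<bar>real (card (tuples E {1..k} u n)) -
          real n ^ card {1..k} * partial_density E {p. prime p \<and> p \<le> N} {1..k} u\<bar>
        \<le> C * \<Theta> * (real n * ln (real n)) ^ card {1..k} / (real n * ln (real n))"
        using n u' le_\<Theta> \<open>1 \<le> \<Theta>\<close> N by (intro C) auto
      also have "\<dots> = B"
        \<comment> \<open>Since \<open>k \<ge> 1\<close> and \<open>n * ln n > 0\<close>, the
          division by \<open>n * ln n\<close> lowers the exponent to \<open>k - 1\<close>.\<close>
        using n assms(1) by (cases k) (simp_all add: B_def power_mult_distrib)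
      also have "partial_density E {p. prime p \<and> p \<le> N} {1..k} u = A N * local_correction k E u"
        unfolding A_def using u' N by (intro partial_density_primes_eq) auto
      finally show ?thesis by (simp add: count)
    qed
    \<comment> \<open>\<open>B\<close> does not depend on \<open>N\<close>, so the bound survives
      the limit of the partial products.\<close>
    then have "eventually (\<lambda>N. \<bar>real (count_tuples k E u n) - real n ^ k * (A N * local_correction k E u)\<bar> \<le> B) sequentially"
      by (rule eventually_sequentiallyI)
    moreover have "A \<longlonglongrightarrow> density_const k E"
      unfolding A_def density_const_def using conv by (rule convergent_prod_LIMSEQ)
    then have "(\<lambda>N. \<bar>real (count_tuples k E u n) - real n ^ k * (A N * local_correction k E u)\<bar>)
        \<longlonglongrightarrow> \<bar>real (count_tuples k E u n) - real n ^ k * (density_const k E * local_correction k E u)\<bar>"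
      by (intro tendsto_intros)
    ultimately have "\<bar>real (count_tuples k E u n) - real n ^ k * (density_const k E * local_correction k E u)\<bar> \<le> B"
      by (intro tendsto_upperbound) auto
    then show "\<bar>real (count_tuples k E u n) - density_const k E * local_correction k E u * real n ^ k\<bar>
         \<le> C * (real (max_squarefree_divisors k u) * real n ^ (k - 1) * ln (real n) ^ (k - 1))"
      by (simp add: B_def \<Theta>_def mult_ac)
  qed
qed

end
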